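(* Let $n\ge1$ and let $L_n$ be the linear octagonal-quadrilateral network. Put $A=15+4\sqrt{14}$, $B=15-4\sqrt{14}$. Then the Kirchhoff index of $L_n$ is \[ Kf(L_n)=\frac{8n(4n+1)(2n+1)}{3}+\frac{(8n+2)\,X_n}{Y_n}, \] where \[ X_n=\frac{1}{196}\big[(98+33\sqrt{14})A^{n}+(98-33\sqrt{14})B^{n}\big]+\frac{9n}{14}\big[(4+\sqrt{14})A^{n}+(4-\sqrt{14})B^{n}\big], \] \[ Y_n=\frac{(116+31\sqrt{14})A^{n-1}-(116-31\sqrt{14})B^{n-1}}{\sqrt{14}}. \]
   Context: The linear octagonal-quadrilateral network $L_n$ is the simple graph with $8n+2$ vertices $1,2,\dots,4n+1$ and $1',2',\dots,(4n+1)'$, and $10n+1$ edges: $\{j,j+1\}$ and $\{j',(j+1)'\}$ for $1\le j\le 4n$, together with the "rungs" $\{j,j'\}$ for $j=1$ and for every $j$ with $4\le j\le 4n+1$ and $j\equiv 0$ or $1\pmod 4$. The Kirchhoff index of a connected graph $G$ is $Kf(G)=\sum_{\{u,v\}}r_{uv}$, summed over unordered pairs of distinct vertices, where $r_{uv}$ is the effective resistance between $u$ and $v$ when each edge is a unit resistor. (In the paper, $X_n=(-1)^{4n}b_{4n}$ and $Y_n=\det L_S$, where $L_S$ is the tridiagonal matrix with off-diagonal entries $-1$ and diagonal $3,2,2,4,4,2,2,4,\dots,4,2,2,4,3$ and $b_{4n}$ is the coefficient of $x$ in $\det(xI-L_S)$.) *)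

theory Defs
  imports Complex_Main
begin

text \<open>
  A simple graph is given by its vertex set \<open>V\<close> and its set \<open>E\<close> of edges, each edge being a
  two-element subset of \<open>V\<close>. Every edge is a unit resistor.

  A potential \<open>p\<close> carries a unit current from \<open>u\<close> to \<open>v\<close> if the net current leaving each vertex
  \<open>x\<close> is 1 at \<open>u\<close>, -1 at \<open>v\<close> and 0 elsewhere (Kirchhoff's current law); by Ohm's law the current
  along the edge from \<open>x\<close> to \<open>y\<close> is \<open>p x - p y\<close>.
\<close>

definition unit_current_potential ::
    "'a set \<Rightarrow> 'a set set \<Rightarrow> 'a \<Rightarrow> 'a \<Rightarrow> ('a \<Rightarrow> real) \<Rightarrow> bool" where
  "unit_current_potential V E u v p \<longleftrightarrow>
     (\<forall>x\<in>V. (\<Sum>y | y \<in> V \<and> {x, y} \<in> E. p x - p y) = of_bool (x = u) - of_bool (x = v))"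

text \<open>
  In a finite connected graph such a potential exists and is unique on \<open>V\<close> up to an additive
  constant, so the potential difference described below is unique. On other graphs the value may be
  unspecified.
\<close>

definition effective_resistance :: "'a set \<Rightarrow> 'a set set \<Rightarrow> 'a \<Rightarrow> 'a \<Rightarrow> real" where
  "effective_resistance V E u v =
     (THE r. \<exists>p. unit_current_potential V E u v p \<and> r = p u - p v)"

lemma effective_resistance_commute:
  "effective_resistance V E u v = effective_resistance V E v u"
proof -
  have swap: "unit_current_potential V E b a (\<lambda>x. - p x)"
    if "unit_current_potential V E a b p" for a b p
  proof -
    have neg: "(\<Sum>y | y \<in> V \<and> {x, y} \<in> E. - p x - - p y)
        = - (\<Sum>y | y \<in> V \<and> {x, y} \<in> E. p x - p y)" for x
      unfolding sum_negf [symmetric] by (rule sum.cong) auto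
    show ?thesis
      using that unfolding unit_current_potential_def neg by auto
  qed
  have imp: "\<exists>q. unit_current_potential V E b a q \<and> r = q b - q a"
    if "\<exists>p. unit_current_potential V E a b p \<and> r = p a - p b" for a b r
  proof -
    from that obtain p where p: "unit_current_potential V E a b p" "r = p a - p b"
      by blast
    have "r = (\<lambda>x. - p x) b - (\<lambda>x. - p x) a"
      using p(2) by simp
    with swap [OF p(1)] show ?thesis
      by blast
  qed
  have "(\<exists>p. unit_current_potential V E u v p \<and> r = p u - p v) \<longleftrightarrow>
      (\<exists>p. unit_current_potential V E v u p \<and> r = p v - p u)" for r
    using imp by blast
  then show ?thesis
    unfolding effective_resistance_def by simp
qed

text \<open>
  The double sum counts each unordered pair of distinct vertices twice, with equal resistances by
  \<open>effective_resistance_commute\<close>; hence the factor 1/2.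
\<close>

definition kirchhoff_index :: "'a set \<Rightarrow> 'a set set \<Rightarrow> real" where
  "kirchhoff_index V E = (1/2) * (\<Sum>u\<in>V. \<Sum>v\<in>V - {u}. effective_resistance V E u v)"

text \<open>
  In the linear octagonal-quadrilateral network, \<open>Inl j\<close> is the vertex \<open>j\<close> and \<open>Inr j\<close> is the
  vertex \<open>j'\<close>.
\<close>

definition oct_quad_vertices :: "nat \<Rightarrow> (nat + nat) set" where
  "oct_quad_vertices n = {1..4*n+1} <+> {1..4*n+1}"

definition oct_quad_rungs :: "nat \<Rightarrow> nat set" where
  "oct_quad_rungs n = {1} \<union> {j. 4 \<le> j \<and> j \<le> 4*n+1 \<and> (j mod 4 = 0 \<or> j mod 4 = 1)}"

definition oct_quad_edges :: "nat \<Rightarrow> (nat + nat) set set" where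
  "oct_quad_edges n =
     {{Inl j, Inl (j+1)} | j. 1 \<le> j \<and> j \<le> 4*n} \<union>
     {{Inr j, Inr (j+1)} | j. 1 \<le> j \<and> j \<le> 4*n} \<union>
     {{Inl j, Inr j} | j. j \<in> oct_quad_rungs n}"

end

theory Submission
  imports Defs
begin

text \<open>
  Splitting potentials into parts symmetric and antisymmetric under \<open>j \<leftrightarrow> j'\<close> turns the Laplacian
  of \<open>L\<^sub>n\<close> into the path Laplacian and the tridiagonal matrix \<open>L\<^sub>S\<close>. Potentials for unit currents are
  explicit on both parts: differences of \<open>\<bar>x - j\<bar>\<close> for the path, columns of \<open>L\<^sub>S\<^sup>-\<^sup>1\<close> for the other.
  Summing the resistances leaves \<open>\<Sum> \<bar>i - j\<bar>\<close> plus the number of vertices times the trace of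
  \<open>L\<^sub>S\<^sup>-\<^sup>1\<close>. The latter is the logarithmic derivative at \<open>t = 0\<close> of \<open>det (L\<^sub>S + t I)\<close>; the leading
  minors and their derivatives satisfy linear recurrences whose four-step transfer matrix has the
  eigenvalues \<open>15 \<plusminus> 4 \<surd>14\<close>.
\<close>

section \<open>Effective resistances\<close>

definition laplacian :: "'a set \<Rightarrow> 'a set set \<Rightarrow> ('a \<Rightarrow> real) \<Rightarrow> 'a \<Rightarrow> real" where
  "laplacian V E p x = (\<Sum>y | y \<in> V \<and> {x, y} \<in> E. p x - p y)"

lemma unit_current_potential_laplacian:
  "unit_current_potential V E u v p \<longleftrightarrow>
     (\<forall>x\<in>V. laplacian V E p x = of_bool (x = u) - of_bool (x = v))"
  by (simp add: unit_current_potential_def laplacian_def)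

text \<open>As a double sum over \<open>V\<close> with the edge indicator as weight, only the cross
  terms differ, and they agree because \<open>{x, y}\<close> is symmetric.\<close>

lemma laplacian_self_adjoint:
  assumes "finite V"
  shows "(\<Sum>x\<in>V. laplacian V E p x * q x) = (\<Sum>x\<in>V. p x * laplacian V E q x)"
proof -
  let ?e = "\<lambda>x y. of_bool ({x, y} \<in> E) :: real"
  have expand: "laplacian V E r x = (\<Sum>y\<in>V. ?e x y * (r x - r y))" for r x
    unfolding laplacian_def using assms
    by (intro sum.mono_neutral_cong_left) auto
  have swap: "(\<Sum>x\<in>V. \<Sum>y\<in>V. ?e x y * (p y * q x)) = (\<Sum>x\<in>V. \<Sum>y\<in>V. ?e x y * (p x * q y))"
    by (subst sum.swap) (simp add: insert_commute)
  show ?thesis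
    using swap
    by (simp add: expand sum_distrib_left sum_distrib_right algebra_simps sum_subtractf)
qed

text \<open>
  Pairing either of two potentials with the Laplacian of the other gives both potential differences,
  which are therefore equal.
\<close>

lemma effective_resistance_eqI:
  assumes "finite V" "u \<in> V" "v \<in> V" and q: "unit_current_potential V E u v q"
  shows "effective_resistance V E u v = q u - q v"
proof -
  have drop: "(\<Sum>x\<in>V. (of_bool (x = u) - of_bool (x = v)) * r x) = r u - r v" for r :: "'a \<Rightarrow> real"
    using assms
    by (simp add: left_diff_distrib sum_subtractf of_bool_def if_distrib[where f = "\<lambda>z. z * _"]
        cong: if_cong)
  have "p u - p v = q u - q v" if p: "unit_current_potential V E u v p" for p
  proof -
    have "q u - q v = (\<Sum>x\<in>V. laplacian V E p x * q x)"
      using p by (simp add: unit_current_potential_laplacian flip: drop)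
    also have "\<dots> = (\<Sum>x\<in>V. laplacian V E q x * p x)"
      by (subst laplacian_self_adjoint[OF assms(1)]) (simp only: mult.commute)
    also have "\<dots> = p u - p v"
      using q by (simp add: unit_current_potential_laplacian flip: drop)
    finally show ?thesis ..
  qed
  with q show ?thesis
    unfolding effective_resistance_def by (intro the_equality) blast+
qed

section \<open>Ladders\<close>

definition ladder_vertices :: "nat \<Rightarrow> (nat + nat) set" where
  "ladder_vertices m = {1..m} <+> {1..m}"

text \<open>The rung set stays arbitrary: the reduction to a path and a tridiagonal matrix does not
  depend on the pattern of rungs.\<close>

definition ladder_edges :: "nat \<Rightarrow> nat set \<Rightarrow> (nat + nat) set set" where
  "ladder_edges m R =
     {{Inl j, Inl (j+1)} | j. 1 \<le> j \<and> j < m} \<union>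
     {{Inr j, Inr (j+1)} | j. 1 \<le> j \<and> j < m} \<union>
     {{Inl j, Inr j} | j. j \<in> R}"

definition path_laplacian :: "nat \<Rightarrow> (nat \<Rightarrow> real) \<Rightarrow> nat \<Rightarrow> real" where
  "path_laplacian m f x =
     of_bool (1 < x) * (f x - f (x - 1)) + of_bool (x < m) * (f x - f (x + 1))"

fun position :: "nat + nat \<Rightarrow> nat" where
  "position (Inl j) = j" | "position (Inr j) = j"

text \<open>The sign that exchanging the two rails flips; it carries the antisymmetric part of a
  potential.\<close>

fun side :: "nat + nat \<Rightarrow> real" where
  "side (Inl j) = 1" | "side (Inr j) = - 1"

fun opposite :: "nat + nat \<Rightarrow> nat + nat" where
  "opposite (Inl j) = Inr j" | "opposite (Inr j) = Inl j"

lemma ladder_laplacian_aux: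
  fixes c :: "nat \<Rightarrow> nat + nat" and g :: "nat + nat \<Rightarrow> real"
  assumes "inj c" "\<And>i. c i \<noteq> z" "1 \<le> x" "x \<le> m"
  shows "sum g ((if 1 < x then {c (x - 1)} else {}) \<union> (if x < m then {c (x + 1)} else {}) \<union>
           (if x \<in> R then {z} else {}))
    = of_bool (1 < x) * g (c (x - 1)) + of_bool (x < m) * g (c (x + 1)) + of_bool (x \<in> R) * g z"
proof -
  have "c i = c j \<longleftrightarrow> i = j" for i j
    using assms(1) by (auto dest: injD)
  with assms(2-) show ?thesis
    by (auto simp: assms(2)[symmetric])
qed

text \<open>Along a rail \<open>side\<close> is constant, so \<open>a\<close> and \<open>b\<close>
  each see the path. Across a rung \<open>a\<close> cancels and \<open>b\<close> changes sign, which
  gives the drop \<open>2 * side v * b\<close>.\<close>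

lemma ladder_laplacian:
  assumes "v \<in> ladder_vertices m"
  shows "laplacian (ladder_vertices m) (ladder_edges m R)
      (\<lambda>w. a (position w) + side w * b (position w)) v
    = path_laplacian m a (position v) +
      side v * (path_laplacian m b (position v) + 2 * of_bool (position v \<in> R) * b (position v))"
proof -
  let ?c = "case v of Inl _ \<Rightarrow> Inl | Inr _ \<Rightarrow> Inr"
  let ?p = "\<lambda>w. a (position w) + side w * b (position w)"
  define x where "x = position v"
  have x: "1 \<le> x" "x \<le> m"
    using assms by (auto simp: x_def ladder_vertices_def)
  have "{y. y \<in> ladder_vertices m \<and> {v, y} \<in> ladder_edges m R} =
      (if 1 < x then {?c (x - 1)} else {}) \<union> (if x < m then {?c (x + 1)} else {}) \<union>
      (if x \<in> R then {opposite v} else {})"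
    using x
    by (cases v)
      (auto simp: x_def ladder_vertices_def ladder_edges_def doubleton_eq_iff
        intro: exI[of _ "x - 1"] split: if_splits)
  then have "laplacian (ladder_vertices m) (ladder_edges m R) ?p v =
      of_bool (1 < x) * (?p v - ?p (?c (x - 1))) + of_bool (x < m) * (?p v - ?p (?c (x + 1))) +
      of_bool (x \<in> R) * (?p v - ?p (opposite v))"
    unfolding laplacian_def using x
    by (simp only:) (rule ladder_laplacian_aux; cases v; auto simp: inj_def)
  then show ?thesis
    by (cases v) (auto simp: x_def path_laplacian_def algebra_simps)
qed

lemma path_laplacian_linear:
  "path_laplacian m (\<lambda>x. k * f x + l * g x) x = k * path_laplacian m f x + l * path_laplacian m g x"
  by (simp add: path_laplacian_def algebra_simps)

text \<open>The slope jumps by 2 at \<open>j\<close>. The end terms do not depend on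
  \<open>j\<close>, so they cancel in a difference of two such functions.\<close>

lemma path_laplacian_dist:
  assumes "1 \<le> j" "j \<le> m" "1 \<le> x" "x \<le> m"
  shows "path_laplacian m (\<lambda>x. \<bar>real x - real j\<bar>) x
    = of_bool (x = 1) + of_bool (x = m) - 2 * of_bool (x = j)"
  using assms by (cases x j rule: linorder_cases) (auto simp: path_laplacian_def of_nat_diff)

lemma ladder_resistance:
  fixes b :: "nat \<Rightarrow> nat \<Rightarrow> real"
  assumes b: "\<And>i x. \<lbrakk>1 \<le> i; i \<le> m; 1 \<le> x; x \<le> m\<rbrakk> \<Longrightarrow>
      path_laplacian m (b i) x + 2 * of_bool (x \<in> R) * b i x = of_bool (x = i)"
    and u: "u \<in> ladder_vertices m" and v: "v \<in> ladder_vertices m"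
  defines "i \<equiv> position u" and "j \<equiv> position v"
  shows "effective_resistance (ladder_vertices m) (ladder_edges m R) u v =
    \<bar>real i - real j\<bar> / 2 + (b i i + b j j) / 2 - side u * side v * (b i j + b j i) / 2"
proof -
  \<comment> \<open>For \<open>x = position w\<close>, the source \<open>of_bool (w = u)\<close> is
    \<open>of_bool (x = i) * (1 + side w * side u) / 2\<close>. So \<open>p\<close> must carry half
    a unit current on the path, and \<open>q\<close> combines columns \<open>b i\<close> and
    \<open>b j\<close> of the inverse with weights \<open>side u / 2\<close> and
    \<open>- side v / 2\<close>.\<close>
  define p where "p = (\<lambda>x. (1/4) * \<bar>real x - real j\<bar> + (-1/4) * \<bar>real x - real i\<bar>)"
  define q where "q = (\<lambda>x. (side u / 2) * b i x + (- side v / 2) * b j x)"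
  let ?r = "\<lambda>w. p (position w) + side w * q (position w)"
  have ij: "1 \<le> i" "i \<le> m" "1 \<le> j" "j \<le> m"
    using u v by (auto simp: i_def j_def ladder_vertices_def)
  have "unit_current_potential (ladder_vertices m) (ladder_edges m R) u v ?r"
    unfolding unit_current_potential_laplacian
  proof
    fix w assume w: "w \<in> ladder_vertices m"
    define x where "x = position w"
    have x: "1 \<le> x" "x \<le> m"
      using w by (auto simp: x_def ladder_vertices_def)
    have P: "path_laplacian m p x = (of_bool (x = i) - of_bool (x = j)) / 2"
      unfolding p_def path_laplacian_linear using ij x by (simp add: path_laplacian_dist)
    have "path_laplacian m q x + 2 * of_bool (x \<in> R) * q x =
        (side u / 2) * (path_laplacian m (b i) x + 2 * of_bool (x \<in> R) * b i x) +
        (- side v / 2) * (path_laplacian m (b j) x + 2 * of_bool (x \<in> R) * b j x)"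
      unfolding q_def path_laplacian_linear by (simp only: algebra_simps)
    then have Q: "path_laplacian m q x + 2 * of_bool (x \<in> R) * q x =
        (side u * of_bool (x = i) - side v * of_bool (x = j)) / 2"
      by (simp only: b[OF ij(1,2) x] b[OF ij(3,4) x]) (simp add: diff_divide_distrib)
    show "laplacian (ladder_vertices m) (ladder_edges m R) ?r w
        = of_bool (w = u) - of_bool (w = v)"
      unfolding ladder_laplacian[OF w] x_def[symmetric] P Q unfolding x_def i_def j_def
      by (cases u; cases v; cases w) auto
  qed
  moreover have "finite (ladder_vertices m)"
    by (simp add: ladder_vertices_def)
  ultimately have "effective_resistance (ladder_vertices m) (ladder_edges m R) u v = ?r u - ?r v"
    using u v by (intro effective_resistance_eqI)
  also have "\<dots> = \<bar>real i - real j\<bar> / 2 + (b i i + b j j) / 2 - side u * side v * (b i j + b j i) / 2"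
    unfolding i_def[symmetric] j_def[symmetric] p_def q_def
    by (cases u; cases v) (auto simp: field_simps)
  finally show ?thesis .
qed

lemma sum_dist_atLeastAtMost:
  "(\<Sum>i\<in>{1..m}. \<Sum>j\<in>{1..m}. \<bar>real i - real j\<bar>) = real m * ((real m)\<^sup>2 - 1) / 3"
proof (induction m)
  case (Suc m)
  have aux: "(\<Sum>j\<in>{1..m}. real (Suc m) - real j) = real m * (real m + 1) / 2"
    using double_gauss_sum_from_Suc_0[of m, where 'a = real] by (simp add: sum_subtractf field_simps)
  have "(\<Sum>j\<in>{1..m}. \<bar>real (Suc m) - real j\<bar>) = real m * (real m + 1) / 2"
    "(\<Sum>j\<in>{1..m}. \<bar>real j - real (Suc m)\<bar>) = real m * (real m + 1) / 2"
    unfolding aux[symmetric] by (auto intro!: sum.cong)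
  moreover have "(\<Sum>i\<in>{1..Suc m}. \<Sum>j\<in>{1..Suc m}. \<bar>real i - real j\<bar>) =
      (\<Sum>i\<in>{1..m}. \<Sum>j\<in>{1..m}. \<bar>real i - real j\<bar>) +
      (\<Sum>i\<in>{1..m}. \<bar>real i - real (Suc m)\<bar>) + (\<Sum>j\<in>{1..m}. \<bar>real (Suc m) - real j\<bar>)"
    by (simp add: sum.distrib)
  ultimately show ?case
    unfolding Suc.IH by (simp only:) (simp add: field_simps power2_eq_square)
qed simp

lemma ladder_kirchhoff_index_trace:
  fixes b :: "nat \<Rightarrow> nat \<Rightarrow> real"
  assumes b: "\<And>i x. \<lbrakk>1 \<le> i; i \<le> m; 1 \<le> x; x \<le> m\<rbrakk> \<Longrightarrow>
      path_laplacian m (b i) x + 2 * of_bool (x \<in> R) * b i x = of_bool (x = i)"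
  shows "kirchhoff_index (ladder_vertices m) (ladder_edges m R) =
    real m * ((real m)\<^sup>2 - 1) / 3 + 2 * real m * (\<Sum>i\<in>{1..m}. b i i)"
proof -
  let ?V = "ladder_vertices m"
  let ?r = "\<lambda>u v. \<bar>real (position u) - real (position v)\<bar> / 2 +
    (b (position u) (position u) + b (position v) (position v)) / 2 -
    side u * side v * (b (position u) (position v) + b (position v) (position u)) / 2"
  have fin: "finite ?V"
    by (simp add: ladder_vertices_def)
  have "(\<Sum>v\<in>?V - {u}. effective_resistance ?V (ladder_edges m R) u v) = (\<Sum>v\<in>?V. ?r u v)"
    if "u \<in> ?V" for u
  proof -
    \<comment> \<open>Hence the diagonal may be included, and summing over both sides kills the
      terms with \<open>side u * side v\<close>.\<close>
    have "?r u u = 0"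
      by (cases u) auto
    then have "(\<Sum>v\<in>?V. ?r u v) = (\<Sum>v\<in>?V - {u}. ?r u v)"
      using sum.remove[OF fin that, of "?r u"] by simp
    then show ?thesis
      using ladder_resistance[OF b that] by simp
  qed
  then have "kirchhoff_index ?V (ladder_edges m R) = (1/2) * (\<Sum>u\<in>?V. \<Sum>v\<in>?V. ?r u v)"
    by (simp add: kirchhoff_index_def)
  also have "\<dots> = (\<Sum>i\<in>{1..m}. \<Sum>j\<in>{1..m}. \<bar>real i - real j\<bar> + b i i + b j j)"
    unfolding ladder_vertices_def
    by (simp add: sum.Plus sum_distrib_left flip: sum.distrib) (simp add: add_divide_distrib algebra_simps)
  also have "\<dots> = (\<Sum>i\<in>{1..m}. \<Sum>j\<in>{1..m}. \<bar>real i - real j\<bar>) + 2 * real m * (\<Sum>i\<in>{1..m}. b i i)"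
    by (simp add: sum.distrib sum_distrib_left mult.assoc)
  finally show ?thesis
    by (simp only: sum_dist_atLeastAtMost)
qed

section \<open>Continuants and the trace of an inverse tridiagonal matrix\<close>

text \<open>
  \<open>continuant d (k + 1)\<close> is the determinant of the \<open>k \<times> k\<close> matrix with diagonal \<open>d 1, \<dots>, d k\<close> and
  off-diagonal entries \<open>-1\<close>, and \<open>continuant_deriv d (k + 1)\<close> is its derivative with respect to a
  common shift of the diagonal.
\<close>

fun continuant :: "(nat \<Rightarrow> real) \<Rightarrow> nat \<Rightarrow> real" where
  "continuant d 0 = 0"
| "continuant d (Suc 0) = 1"
| "continuant d (Suc (Suc k)) = d (Suc k) * continuant d (Suc k) - continuant d k"

fun continuant_deriv :: "(nat \<Rightarrow> real) \<Rightarrow> nat \<Rightarrow> real" where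
  "continuant_deriv d 0 = 0"
| "continuant_deriv d (Suc 0) = 0"
| "continuant_deriv d (Suc (Suc k)) =
     d (Suc k) * continuant_deriv d (Suc k) - continuant_deriv d k + continuant d (Suc k)"

text \<open>The determinant of the trailing block with rows \<open>i + 1\<close> to
  \<open>m\<close>, read from the far end.\<close>

definition co_continuant :: "nat \<Rightarrow> (nat \<Rightarrow> real) \<Rightarrow> nat \<Rightarrow> real" where
  "co_continuant m d i = continuant (\<lambda>k. d (m + 1 - k)) (m + 1 - i)"

lemma co_continuant_end [simp]:
  "co_continuant m d (Suc m) = 0" "co_continuant m d m = 1"
  by (simp_all add: co_continuant_def)

lemma co_continuant_rec:
  assumes "i < m"
  shows "co_continuant m d i =
    d (Suc i) * co_continuant m d (Suc i) - co_continuant m d (Suc (Suc i))"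
proof -
  from assms obtain k where "m = Suc (i + k)"
    using less_iff_Suc_add by auto
  then show ?thesis
    by (simp add: co_continuant_def Suc_diff_le)
qed

text \<open>Both sequences solve the same three-term recurrence, so their Wronskian is constant in
  \<open>i\<close>; it is evaluated at \<open>i = m\<close>.\<close>

lemma continuant_wronskian:
  assumes "i \<le> m"
  shows "continuant d (Suc i) * co_continuant m d i - continuant d i * co_continuant m d (Suc i)
    = continuant d (Suc m)"
  using assms
proof (induction rule: inc_induct)
  case (step i)
  then show ?case
    by (simp add: co_continuant_rec algebra_simps)
qed simp

text \<open>The derivative of the determinant is the sum of its principal minors, each a leading
  times a trailing block. In the proof, the extra term in the recurrence of
  \<open>continuant_deriv\<close> makes its Wronskian with \<open>co_continuant\<close> grow by one
  summand per step.\<close>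

lemma continuant_deriv_eq_sum:
  "continuant_deriv d (Suc m) = (\<Sum>i\<in>{1..m}. continuant d i * co_continuant m d i)"
proof -
  have "k \<le> m \<Longrightarrow> continuant_deriv d (Suc k) * co_continuant m d k -
      continuant_deriv d k * co_continuant m d (Suc k) =
      (\<Sum>i\<in>{1..k}. continuant d i * co_continuant m d i)" for k
  proof (induction k)
    case (Suc k)
    then show ?case
      by (simp add: co_continuant_rec algebra_simps)
  qed simp
  from this[of m] show ?thesis
    by simp
qed

text \<open>The discrete Green's function: a solution vanishing at 0 glued to one vanishing at
  \<open>m + 1\<close>, normalised by their Wronskian.\<close>

definition tridiag_inverse :: "nat \<Rightarrow> (nat \<Rightarrow> real) \<Rightarrow> nat \<Rightarrow> nat \<Rightarrow> real" where
  "tridiag_inverse m d i j =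
     continuant d (min i j) * co_continuant m d (max i j) / continuant d (Suc m)"

lemma tridiag_inverse_end [simp]:
  "tridiag_inverse m d i 0 = 0" "i \<le> m \<Longrightarrow> tridiag_inverse m d i (Suc m) = 0"
  by (simp_all add: tridiag_inverse_def max_absorb2)

text \<open>Off the diagonal this is the recurrence of one factor; on the diagonal it is the
  Wronskian identity.\<close>

lemma tridiag_inverse_row:
  assumes nz: "continuant d (Suc m) \<noteq> 0" and "1 \<le> i" "i \<le> m" "x < m"
  shows "d (Suc x) * tridiag_inverse m d i (Suc x) - tridiag_inverse m d i x
    - tridiag_inverse m d i (Suc (Suc x)) = of_bool (Suc x = i)"
proof (cases "Suc x" i rule: linorder_cases)
  case less
  with nz show ?thesis
    by (cases "i = Suc (Suc x)")
      (simp_all add: tridiag_inverse_def min_def max_def field_simps)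
next
  case greater
  then show ?thesis
    using nz co_continuant_rec[OF \<open>x < m\<close>, of d]
    by (auto simp: tridiag_inverse_def min_def max_def less_Suc_eq_le) (simp add: field_simps)
next
  case equal
  have "continuant d (Suc (Suc x)) * co_continuant m d (Suc x) -
      continuant d (Suc x) * co_continuant m d (Suc (Suc x)) = continuant d (Suc m)"
    using assms by (intro continuant_wronskian) auto
  with equal nz show ?thesis
    by (auto simp: tridiag_inverse_def min_def max_def) (simp add: field_simps)
qed

definition ladder_diag :: "nat \<Rightarrow> nat set \<Rightarrow> nat \<Rightarrow> real" where
  "ladder_diag m R x = of_bool (1 < x) + of_bool (x < m) + 2 * of_bool (x \<in> R)"

theorem ladder_kirchhoff_index:
  assumes nz: "continuant (ladder_diag m R) (Suc m) \<noteq> 0"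
  shows "kirchhoff_index (ladder_vertices m) (ladder_edges m R) =
    real m * ((real m)\<^sup>2 - 1) / 3 +
    2 * real m * continuant_deriv (ladder_diag m R) (Suc m) / continuant (ladder_diag m R) (Suc m)"
proof -
  let ?d = "ladder_diag m R"
  let ?b = "tridiag_inverse m ?d"
  have "path_laplacian m (?b i) x + 2 * of_bool (x \<in> R) * ?b i x = of_bool (x = i)"
    if i: "1 \<le> i" "i \<le> m" and x: "1 \<le> x" "x \<le> m" for i x
  proof -
    obtain y where y: "x = Suc y" "y < m"
      using x by (cases x) auto
    \<comment> \<open>\<open>path_laplacian\<close> omits the missing neighbour at an end; the row
      identity keeps it, but with value 0.\<close>
    have "y = 0 \<Longrightarrow> ?b i y = 0" "\<not> Suc y < m \<Longrightarrow> ?b i (Suc (Suc y)) = 0"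
      using i y by (auto simp: not_less dest: le_antisym)
    then show ?thesis
      using tridiag_inverse_row[OF nz i y(2)] y
      by (auto simp: path_laplacian_def ladder_diag_def algebra_simps)
  qed
  then have "kirchhoff_index (ladder_vertices m) (ladder_edges m R) =
      real m * ((real m)\<^sup>2 - 1) / 3 + 2 * real m * (\<Sum>i\<in>{1..m}. ?b i i)"
    by (rule ladder_kirchhoff_index_trace)
  also have "(\<Sum>i\<in>{1..m}. ?b i i) = continuant_deriv ?d (Suc m) / continuant ?d (Suc m)"
    by (simp add: tridiag_inverse_def continuant_deriv_eq_sum sum_divide_distrib)
  finally show ?thesis
    by simp
qed

section \<open>The octagonal-quadrilateral network\<close>

lemma oct_quad_ladder:
  "oct_quad_vertices n = ladder_vertices (4*n+1)"
  "oct_quad_edges n = ladder_edges (4*n+1) (oct_quad_rungs n)"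
  by (simp_all add: oct_quad_vertices_def ladder_vertices_def oct_quad_edges_def ladder_edges_def
      less_Suc_eq_le)

abbreviation oct_quad_diag :: "nat \<Rightarrow> nat \<Rightarrow> real" where
  "oct_quad_diag n \<equiv> ladder_diag (4*n+1) (oct_quad_rungs n)"

lemma oct_quad_diag:
  assumes "k < n"
  shows "oct_quad_diag n (4*k+1) = (if k = 0 then 3 else 4)" "oct_quad_diag n (4*k+2) = 2"
    "oct_quad_diag n (4*k+3) = 2" "oct_quad_diag n (4*k+4) = 4"
proof -
  have "(4*k+1) mod 4 = 1" "(4*k+2) mod 4 = 2" "(4*k+3) mod 4 = 3" "(4*k+4) mod 4 = 0"
    by presburger+
  with assms show "oct_quad_diag n (4*k+1) = (if k = 0 then 3 else 4)"
    "oct_quad_diag n (4*k+2) = 2" "oct_quad_diag n (4*k+3) = 2" "oct_quad_diag n (4*k+4) = 4"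
    unfolding ladder_diag_def oct_quad_rungs_def by auto
qed

lemma oct_quad_diag_last: "1 \<le> n \<Longrightarrow> oct_quad_diag n (4*n+1) = 3"
  unfolding ladder_diag_def oct_quad_rungs_def by (simp add: mod_Suc)

text \<open>One period of the diagonal. The entry \<open>d (j+1)\<close> stays free because it is 3
  in the first period and 4 later.\<close>

lemma continuant_four_steps:
  assumes "d (j+2) = 2" "d (j+3) = 2" "d (j+4) = 4"
  defines "f \<equiv> continuant d" and "w \<equiv> continuant_deriv d"
  defines "f2 \<equiv> d (j+1) * f (j+1) - f j"
    and "w2 \<equiv> d (j+1) * w (j+1) - w j + f (j+1)"
  shows "f (j+4) = 3 * f2 - 2 * f (j+1)" "f (j+5) = 10 * f2 - 7 * f (j+1)"
    "w (j+4) = 3 * w2 - 2 * w (j+1) + 4 * f2 - f (j+1)"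
    "w (j+5) = 10 * w2 - 7 * w (j+1) + 18 * f2 - 6 * f (j+1)"
  using assms(1-3) unfolding f2_def w2_def f_def w_def
  by (simp_all add: numeral_eq_Suc)

text \<open>The derivative recurrence is driven at its own eigenvalues, hence the terms
  \<open>k * A^k\<close> and \<open>k * B^k\<close>. Induction starts at 1: at \<open>k = 0\<close>
  the first formula would give 1, not \<open>continuant d 0 = 0\<close>.\<close>

lemma oct_quad_continuant:
  fixes n k :: nat and A B s :: real
  assumes "1 \<le> k" "k \<le> n" and s: "s * s = 14" and A: "A = 15 + 4 * s" and B: "B = 15 - 4 * s"
  shows "continuant (oct_quad_diag n) (4*k) = (1/2 - s/14) * A^k + (1/2 + s/14) * B^k \<and>
    continuant (oct_quad_diag n) (4*k+1) = (1/2 + s/14) * A^k + (1/2 - s/14) * B^k \<and>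
    continuant_deriv (oct_quad_diag n) (4*k) =
      (- 19 * s/784 + real k * (9 * s/28 - 9/14)) * A^k +
      (19 * s/784 + real k * (- 9/14 - 9 * s/28)) * B^k \<and>
    continuant_deriv (oct_quad_diag n) (4*k+1) =
      (19 * s/784 + real k * (9 * s/28 + 9/14)) * A^k +
      (- 19 * s/784 + real k * (9/14 - 9 * s/28)) * B^k"
  using assms(1,2)
proof (induction k rule: nat_induct_at_least)
  case base
  have ss: "s * (s * x) = 14 * x" for x
    using s by (simp flip: mult.assoc)
  have d: "0 < n" using base by simp
  show ?case
    using continuant_four_steps[of "oct_quad_diag n" 0] oct_quad_diag[OF d]
    by (simp add: A B field_simps s ss)
next
  case (Suc k)
  have ss: "s * (s * x) = 14 * x" for x
    using s by (simp flip: mult.assoc)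
  have idx: "4 * Suc k = 4*k+4" "4*k+4+1 = 4*k+5"
    by simp_all
  have d: "k < n" "k \<noteq> 0" using Suc by auto
  note IH = Suc.IH[OF less_imp_le[OF d(1)]]
  define P Q where "P = A ^ k" and "Q = B ^ k"
  have PQ: "A ^ Suc k = 15 * P + 4 * (s * P)" "B ^ Suc k = 15 * Q - 4 * (s * Q)"
    by (simp_all add: A B P_def Q_def algebra_simps)
  show ?case
    unfolding idx continuant_four_steps[of "oct_quad_diag n" "4*k", OF oct_quad_diag(2-4)[OF d(1)]]
      oct_quad_diag(1)[OF d(1)]
    using IH unfolding PQ P_def[symmetric] Q_def[symmetric]
    using d(2) by (simp add: field_simps s ss)
qed

theorem theorem3p5:
  fixes n :: nat and A B X Y :: real
  assumes "n \<ge> 1"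
    and "A = 15 + 4 * sqrt 14"
    and "B = 15 - 4 * sqrt 14"
    and "X = (1/196) * ((98 + 33 * sqrt 14) * A ^ n + (98 - 33 * sqrt 14) * B ^ n)
           + (9 * real n / 14) * ((4 + sqrt 14) * A ^ n + (4 - sqrt 14) * B ^ n)"
    and "Y = ((116 + 31 * sqrt 14) * A ^ (n - 1) - (116 - 31 * sqrt 14) * B ^ (n - 1)) / sqrt 14"
  shows "kirchhoff_index (oct_quad_vertices n) (oct_quad_edges n) =
           8 * real n * (4 * real n + 1) * (2 * real n + 1) / 3 + (8 * real n + 2) * X / Y"
proof -
  define s where "s = sqrt (14::real)"
  have s: "s * s = 14" and s_pos: "0 < s"
    by (simp_all add: s_def)
  have ss: "s * (s * x) = 14 * x" for x
    using s by (simp flip: mult.assoc)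
  \<comment> \<open>Squared, this is 13454 < 13456; it also implies \<open>0 < B\<close>.\<close>
  have s_less: "31 * s < 116"
    unfolding s_def by (rule power2_less_imp_less) (auto simp: power_mult_distrib)
  have AB: "A = 15 + 4 * s" "B = 15 - 4 * s"
    using assms by (simp_all add: s_def)
  obtain k where k: "n = Suc k"
    using assms(1) by (cases n) auto
  let ?d = "oct_quad_diag n"
  let ?m = "4 * n + 1"
  have d: "?d (4*n+1) = 3"
    using assms(1) by (rule oct_quad_diag_last)
  note closed = oct_quad_continuant[OF assms(1) order.refl s AB]
  have Y1: "Y = (1 + 2*s/7) * A^n + (1 - 2*s/7) * B^n"
    using s_pos unfolding assms(5) s_def[symmetric] k AB(1,2)
    by (simp add: field_simps s ss)
  \<comment> \<open>The final diagonal entry 3 adds one recurrence step to the closed forms at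
    \<open>k = n\<close>.\<close>
  have Y: "continuant ?d (Suc ?m) = Y"
    unfolding Y1 using closed d by (simp add: algebra_simps)
  have X: "continuant_deriv ?d (Suc ?m) = X"
    unfolding assms(4) s_def[symmetric] using closed d by (simp add: algebra_simps)
  \<comment> \<open>The \<open>A\<close> term of \<open>Y\<close> strictly dominates the
    \<open>B\<close> term, so \<open>Y\<close> is nonzero.\<close>
  have "B ^ k \<le> A ^ k" "0 < A ^ k"
    using s_less s_pos unfolding AB by (auto intro: power_mono)
  then have "(116 - 31 * s) * B ^ k \<le> (116 - 31 * s) * A ^ k"
    using s_less by (intro mult_left_mono) auto
  also have "\<dots> < (116 + 31 * s) * A ^ k"
    using s_pos \<open>0 < A ^ k\<close> by (intro mult_strict_right_mono) auto
  finally have "Y \<noteq> 0"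
    using s_pos unfolding assms(5) s_def[symmetric] k by simp
  then have "kirchhoff_index (ladder_vertices ?m) (ladder_edges ?m (oct_quad_rungs n)) =
      real ?m * ((real ?m)\<^sup>2 - 1) / 3 + 2 * real ?m * X / Y"
    using ladder_kirchhoff_index[of ?m "oct_quad_rungs n"] unfolding X Y by blast
  also have "\<dots> = 8 * real n * (4 * real n + 1) * (2 * real n + 1) / 3 + (8 * real n + 2) * X / Y"
    by (simp add: power2_eq_square algebra_simps)
  finally show ?thesis
    unfolding oct_quad_ladder .
qed

end
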